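(* Let $G$ be a connected graph of order at least $3$, and let $r_1, r_2$ be positive numbers. If $r_1<r_2$, then $$\chi_{r_1-vsdt}(G)\le \chi_{r_2-vsdt}(G).$$
   Context: All graphs are finite, simple and undirected. For a vertex $u$ of $G$, let $N\langle u\rangle = N[u]\cup\{uv : v\in N(u)\}$, where $N(u)$ and $N[u]=N(u)\cup\{u\}$ are the open and closed neighborhoods; so $N\langle u\rangle$ consists of $u$, its neighbors and its incident edges. A proper $\kappa$-total coloring of $G$ is a map $f:V(G)\cup E(G)\to\{1,\dots,\kappa\}$ such that any two adjacent vertices, any two edges sharing an endpoint, and any vertex and incident edge receive different colors. Put $C_f\langle u\rangle=\{f(x): x\in N\langle u\rangle\}$. For a graph $G$ with no isolated edges (no connected component is $K_2$) and a positive number $r$, a $\kappa$-$r$-vertex-strongly-distinguishing total coloring ($\kappa$-$D(r)$-VSDTC) of $G$ is a proper $\kappa$-total coloring $f$ such that $C_f\langle u\rangle\neq C_f\langle v\rangle$ for any two distinct vertices $u,v$ at distance at most $r$ (vertices in different components are at infinite distance). $\chi_{r-vsdt}(G)$ is the minimum $\kappa$ for which $G$ admits a $\kappa$-$D(r)$-VSDTC. *)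

theory Defs
  imports "HOL-Library.Extended_Real"
begin

text \<open>
  A graph is a vertex set \<open>V\<close> together with a set \<open>E\<close> of two-element subsets of \<open>V\<close>.
\<close>

definition fin_simple_graph :: "'a set \<Rightarrow> 'a set set \<Rightarrow> bool" where
  "fin_simple_graph V E \<longleftrightarrow> finite V \<and> (\<forall>e\<in>E. e \<subseteq> V \<and> card e = 2)"

text \<open>Paths are given by their nonempty list of pairwise distinct vertices.\<close>

definition path_betw :: "'a set \<Rightarrow> 'a set set \<Rightarrow> 'a \<Rightarrow> 'a list \<Rightarrow> 'a \<Rightarrow> bool" where
  "path_betw V E u p v \<longleftrightarrow>
     p \<noteq> [] \<and> hd p = u \<and> last p = v \<and> set p \<subseteq> V \<and> distinct p \<and>
     successively (\<lambda>x y. {x, y} \<in> E) p"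

definition connected_graph :: "'a set \<Rightarrow> 'a set set \<Rightarrow> bool" where
  "connected_graph V E \<longleftrightarrow> V \<noteq> {} \<and> (\<forall>u\<in>V. \<forall>v\<in>V. \<exists>p. path_betw V E u p v)"

text \<open>
  The number of edges of a shortest path; it is \<open>\<infinity>\<close>, the infimum of the empty set,
  for vertices in different components.
\<close>

definition graph_dist :: "'a set \<Rightarrow> 'a set set \<Rightarrow> 'a \<Rightarrow> 'a \<Rightarrow> enat" where
  "graph_dist V E u v = Inf {enat (length p - 1) | p. path_betw V E u p v}"

definition open_nbhd :: "'a set set \<Rightarrow> 'a \<Rightarrow> 'a set" where
  "open_nbhd E u = {v. {u, v} \<in> E}"

definition closed_nbhd :: "'a set set \<Rightarrow> 'a \<Rightarrow> 'a set" where
  "closed_nbhd E u = insert u (open_nbhd E u)"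

text \<open>
  The disjoint union of vertices and edges is modelled by the sum type \<^typ>\<open>'a + 'a set\<close>:
  \<open>Inl v\<close> is the vertex \<open>v\<close> and \<open>Inr e\<close> the edge \<open>e\<close>. The set \<open>total_nbhd E u\<close> is
  \<open>N\<langle>u\<rangle>\<close>, and \<open>color_set E f u\<close> is \<open>C\<^sub>f\<langle>u\<rangle>\<close>.
\<close>

definition total_nbhd :: "'a set set \<Rightarrow> 'a \<Rightarrow> ('a + 'a set) set" where
  "total_nbhd E u = Inl ` closed_nbhd E u \<union> Inr ` {{u, v} | v. v \<in> open_nbhd E u}"

definition color_set :: "'a set set \<Rightarrow> ('a + 'a set \<Rightarrow> nat) \<Rightarrow> 'a \<Rightarrow> nat set" where
  "color_set E f u = f ` total_nbhd E u"

definition proper_total_coloring ::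
    "'a set \<Rightarrow> 'a set set \<Rightarrow> nat \<Rightarrow> ('a + 'a set \<Rightarrow> nat) \<Rightarrow> bool" where
  "proper_total_coloring V E \<kappa> f \<longleftrightarrow>
     (\<forall>x \<in> Inl ` V \<union> Inr ` E. f x \<in> {1..\<kappa>}) \<and>
     (\<forall>u v. {u, v} \<in> E \<longrightarrow> f (Inl u) \<noteq> f (Inl v)) \<and>
     (\<forall>e\<in>E. \<forall>e'\<in>E. e \<noteq> e' \<and> e \<inter> e' \<noteq> {} \<longrightarrow> f (Inr e) \<noteq> f (Inr e')) \<and>
     (\<forall>e\<in>E. \<forall>v\<in>e. f (Inl v) \<noteq> f (Inr e))"

definition vsdtc ::
    "'a set \<Rightarrow> 'a set set \<Rightarrow> nat \<Rightarrow> real \<Rightarrow> ('a + 'a set \<Rightarrow> nat) \<Rightarrow> bool" where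
  "vsdtc V E \<kappa> r f \<longleftrightarrow>
     proper_total_coloring V E \<kappa> f \<and>
     (\<forall>u\<in>V. \<forall>v\<in>V. u \<noteq> v \<and> ereal_of_enat (graph_dist V E u v) \<le> ereal r \<longrightarrow>
        color_set E f u \<noteq> color_set E f v)"

text \<open>
  The least \<open>\<kappa>\<close> is an unspecified value if no colouring exists. For \<open>r > 0\<close> and a finite simple
  graph without isolated edges one does exist, for instance any injective colouring:
  \<open>N\<langle>u\<rangle> = N\<langle>v\<rangle>\<close> with \<open>u \<noteq> v\<close> forces \<open>uv\<close> to be the only edge at \<open>u\<close> and at \<open>v\<close>.
\<close>

definition chi_vsdt :: "real \<Rightarrow> 'a set \<Rightarrow> 'a set set \<Rightarrow> nat" where
  "chi_vsdt r V E = (LEAST \<kappa>. \<exists>f. vsdtc V E \<kappa> r f)"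

end

theory Submission
  imports Defs
begin

text \<open>
  A colouring that distinguishes vertices up to distance \<open>r\<^sub>2\<close> also does so up to \<open>r\<^sub>1 < r\<^sub>2\<close>, so
  the minimum for \<open>r\<^sub>1\<close> is at most the one for \<open>r\<^sub>2\<close>, provided that the latter is attained. It is:
  any injective colouring works, since \<open>N\<langle>u\<rangle> = N\<langle>v\<rangle>\<close> with \<open>u \<noteq> v\<close> makes \<open>{u, v}\<close> a connected
  component.
\<close>

lemma vsdtc_antimono:
  assumes "vsdtc V E \<kappa> r2 f" and "r1 \<le> r2"
  shows "vsdtc V E \<kappa> r1 f"
proof -
  have "x \<le> ereal r2" if "x \<le> ereal r1" for x
    using that \<open>r1 \<le> r2\<close> by (meson ereal_less_eq(3) order_trans)
  then show ?thesis
    using assms(1) unfolding vsdtc_def by blast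
qed

text \<open>Induction along the list: each step of a walk that starts in \<open>S\<close> stays in
  \<open>S\<close>.\<close>

lemma successively_closed:
  assumes "successively R xs" and "xs \<noteq> []" and "hd xs \<in> S"
    and "\<And>x y. x \<in> S \<Longrightarrow> R x y \<Longrightarrow> y \<in> S"
  shows "set xs \<subseteq> S"
  using assms(1-3)
proof (induction xs)
  case (Cons x xs)
  then show ?case
    by (cases xs) (auto dest: assms(4))
qed simp

text \<open>A path from \<open>u\<close> can never leave \<open>S\<close>, yet paths from
  \<open>u\<close> reach every vertex.\<close>

lemma connected_graph_closed_set:
  assumes "connected_graph V E" and "u \<in> V" and "u \<in> S"
    and "\<And>x. x \<in> S \<Longrightarrow> open_nbhd E x \<subseteq> S"
  shows "V \<subseteq> S"
proof
  fix w assume "w \<in> V"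
  then obtain p where p: "path_betw V E u p w"
    using assms(1,2) unfolding connected_graph_def by blast
  then have "set p \<subseteq> S"
    using successively_closed[of "\<lambda>x y. {x, y} \<in> E" p S] assms(3,4)
    unfolding path_betw_def open_nbhd_def by blast
  then show "w \<in> S"
    using p last_in_set unfolding path_betw_def by blast
qed

text \<open>The edges alone decide this: an edge at \<open>u\<close> that also lies in the total
  neighborhood of \<open>v\<close> is incident to \<open>v\<close>, so its other end is
  \<open>v\<close>.\<close>

lemma total_nbhd_eq_imp_open_nbhd:
  assumes "total_nbhd E u = total_nbhd E v" and "u \<noteq> v"
  shows "open_nbhd E u \<subseteq> {v}"
proof
  fix w assume "w \<in> open_nbhd E u"
  then have "Inr {u, w} \<in> total_nbhd E u"
    by (auto simp: total_nbhd_def)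
  then have "Inr {u, w} \<in> total_nbhd E v"
    by (simp only: assms(1))
  then obtain x where "{u, w} = {v, x}"
    by (auto simp: total_nbhd_def)
  then show "w \<in> {v}"
    using \<open>u \<noteq> v\<close> by (simp add: doubleton_eq_iff)
qed

text \<open>If \<open>u\<close> and \<open>v\<close> collided, \<open>{u, v}\<close> would be closed
  under taking neighbors, so by connectedness it would contain all of \<open>V\<close>, which has at
  least three vertices.\<close>

lemma inj_on_total_nbhd:
  assumes "connected_graph V E" and "card V \<ge> 3"
  shows "inj_on (total_nbhd E) V"
proof (rule inj_onI, rule ccontr)
  fix u v assume u: "u \<in> V" and eq: "total_nbhd E u = total_nbhd E v" and "u \<noteq> v"
  have "open_nbhd E u \<subseteq> {v}" and "open_nbhd E v \<subseteq> {u}"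
    using total_nbhd_eq_imp_open_nbhd[OF eq \<open>u \<noteq> v\<close>]
      total_nbhd_eq_imp_open_nbhd[OF eq[symmetric] \<open>u \<noteq> v\<close>[symmetric]] .
  then have "open_nbhd E x \<subseteq> {u, v}" if "x \<in> {u, v}" for x
    using that by blast
  with assms(1) u have "V \<subseteq> {u, v}"
    by (intro connected_graph_closed_set[of V E u]) simp_all
  then have "card V \<le> card {u, v}"
    by (rule card_mono[rotated]) simp
  then show False
    using \<open>card V \<ge> 3\<close> \<open>u \<noteq> v\<close> by simp
qed

lemma total_nbhd_subset:
  assumes "fin_simple_graph V E" and "u \<in> V"
  shows "total_nbhd E u \<subseteq> Inl ` V \<union> Inr ` E"
proof -
  have "{u, v} \<subseteq> V" if "{u, v} \<in> E" for v
    using assms(1) that unfolding fin_simple_graph_def by blast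
  then show ?thesis
    using assms(2) by (auto simp: total_nbhd_def closed_nbhd_def open_nbhd_def)
qed

lemma inj_on_proper_total_coloring:
  assumes G: "fin_simple_graph V E" and inj: "inj_on f (Inl ` V \<union> Inr ` E)"
    and "f ` (Inl ` V \<union> Inr ` E) \<subseteq> {1..\<kappa>}"
  shows "proper_total_coloring V E \<kappa> f"
  unfolding proper_total_coloring_def
proof (intro conjI allI ballI impI)
  show "f x \<in> {1..\<kappa>}" if "x \<in> Inl ` V \<union> Inr ` E" for x
    using that assms(3) by blast
next
  fix u v assume e: "{u, v} \<in> E"
  \<comment> \<open>Edges have two elements, so loops are excluded and injectivity applies to
    distinct vertices.\<close>
  then have "card {u, v} = 2" and "u \<in> V" and "v \<in> V"
    using G unfolding fin_simple_graph_def by auto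
  then have "u \<noteq> v"
    by auto
  then show "f (Inl u) \<noteq> f (Inl v)"
    using inj_on_eq_iff[OF inj, of "Inl u" "Inl v"] \<open>u \<in> V\<close> \<open>v \<in> V\<close> by simp
next
  fix e e' assume "e \<in> E" "e' \<in> E" "e \<noteq> e' \<and> e \<inter> e' \<noteq> {}"
  then show "f (Inr e) \<noteq> f (Inr e')"
    using inj_on_eq_iff[OF inj, of "Inr e" "Inr e'"] by simp
next
  fix e v assume "e \<in> E" "v \<in> e"
  moreover from this have "v \<in> V"
    using G unfolding fin_simple_graph_def by blast
  ultimately show "f (Inl v) \<noteq> f (Inr e)"
    using inj_on_eq_iff[OF inj, of "Inl v" "Inr e"] by simp
qed

text \<open>Any \<open>r\<close> is allowed, because an injective coloring separates all pairs of
  vertices, whatever their distance.\<close>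

lemma exists_vsdtc:
  assumes G: "fin_simple_graph V E" and "connected_graph V E" and "card V \<ge> 3"
  shows "\<exists>\<kappa> f. vsdtc V E \<kappa> r f"
proof -
  let ?X = "Inl ` V \<union> Inr ` E :: ('a + 'a set) set"
  have "E \<subseteq> Pow V" and "finite V"
    using G unfolding fin_simple_graph_def by auto
  then have "finite ?X"
    using finite_subset by fastforce
  \<comment> \<open>Number all vertices and edges consecutively from 1, one color each.\<close>
  then obtain f where f: "bij_betw f ?X {1..card ?X}"
    using finite_same_card_bij[of ?X "{1..card ?X}"] by auto
  then have inj: "inj_on f ?X"
    by (rule bij_betw_imp_inj_on)
  \<comment> \<open>Since \<open>f\<close> is injective on \<open>?X\<close>, equal color sets would
    come from equal total neighborhoods.\<close>
  have "color_set E f u \<noteq> color_set E f v" if "u \<in> V" "v \<in> V" "u \<noteq> v" for u v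
    using that inj_on_eq_iff[OF inj_on_total_nbhd[OF assms(2,3)], of u v]
      inj_on_image_eq_iff[OF inj total_nbhd_subset[OF G] total_nbhd_subset[OF G], of u v]
    unfolding color_set_def by simp
  moreover have "proper_total_coloring V E (card ?X) f"
    using inj_on_proper_total_coloring[OF G inj] f by (simp add: bij_betw_def)
  ultimately show ?thesis
    unfolding vsdtc_def by blast
qed

theorem theorem1p3:
  fixes V :: "'a set" and E :: "'a set set" and r1 r2 :: real
  assumes "fin_simple_graph V E"
    and "connected_graph V E"
    and "card V \<ge> 3"
    and "r1 > 0" and "r2 > 0"
    and "r1 < r2"
  shows "chi_vsdt r1 V E \<le> chi_vsdt r2 V E"
proof -
  \<comment> \<open>Existence of a coloring guarantees that the \<open>LEAST\<close> is
    attained.\<close>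
  have "\<exists>f. vsdtc V E (chi_vsdt r2 V E) r2 f"
    unfolding chi_vsdt_def using exists_vsdtc[OF assms(1-3)] by (rule LeastI_ex)
  then have "\<exists>f. vsdtc V E (chi_vsdt r2 V E) r1 f"
    using vsdtc_antimono \<open>r1 < r2\<close> less_imp_le by blast
  then show ?thesis
    \<comment> \<open>Only the \<open>r1\<close> side is unfolded; \<open>chi_vsdt r2 V E\<close>
      stays as the candidate compared with the minimum.\<close>
    unfolding chi_vsdt_def[of r1] by (rule Least_le)
qed

end
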